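(* For every integer $n\ge 2$, the friendship graph $F_n$ satisfies $\operatorname{st}_{\gamma_{st}}(F_n)=1$.
   Context: All graphs are finite, simple and undirected. For a graph $G=(V,E)$, a set $D\subseteq V$ is a strong dominating set if every vertex $v\in V\setminus D$ is adjacent to some $u\in D$ with $\deg(v)\le\deg(u)$ (degrees taken in $G$). The strong domination number $\gamma_{st}(G)$ is the minimum size of a strong dominating set. For $S\subseteq V$, $G-S$ is the graph obtained by deleting the vertices of $S$. The stability of the strong domination number is $\operatorname{st}_{\gamma_{st}}(G)=\min\{|S| : S\subseteq V,\ \gamma_{st}(G-S)\ne\gamma_{st}(G)\}$. The friendship graph $F_n$ is obtained by identifying one vertex from each of $n$ copies of the triangle $C_3$; equivalently it is the join $K_1\vee nK_2$ of a single vertex with $n$ disjoint edges. *)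

theory Defs
  imports "Graph_Theory.Graph_Theory"
begin

text \<open>
  Finite simple undirected graphs are the instances of the locale \<^locale>\<open>graph\<close>: every edge
  is represented by a pair of opposite arcs, without loops or parallel arcs. Thus adjacency
  is \<^const>\<open>dominates\<close>, and the degree of a vertex is its \<^const>\<open>out_degree\<close>.
\<close>

definition strong_dominating_set :: "('a, 'b) pre_digraph \<Rightarrow> 'a set \<Rightarrow> bool" where
  "strong_dominating_set G D \<longleftrightarrow> D \<subseteq> verts G \<and>
     (\<forall>v \<in> verts G - D. \<exists>u \<in> D. v \<rightarrow>\<^bsub>G\<^esub> u \<and> out_degree G v \<le> out_degree G u)"

definition strong_domination_number :: "('a, 'b) pre_digraph \<Rightarrow> nat" where
  "strong_domination_number G = Min {card D | D. strong_dominating_set G D}"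

definition delete_verts :: "('a, 'b) pre_digraph \<Rightarrow> 'a set \<Rightarrow> ('a, 'b) pre_digraph" where
  "delete_verts G S = G \<restriction> (verts G - S)"

text \<open>
  Deleting all vertices is allowed; the graph without vertices has strong domination number 0.
  Hence the minimum below is over a nonempty set unless \<open>G\<close> itself has no vertices.
\<close>

definition strong_domination_stability :: "('a, 'b) pre_digraph \<Rightarrow> nat" where
  "strong_domination_stability G =
     Min {card S | S. S \<subseteq> verts G \<and>
            strong_domination_number (delete_verts G S) \<noteq> strong_domination_number G}"

text \<open>
  The \<open>i\<close>-th triangle has vertices \<open>None\<close>, \<open>Some (i, False)\<close> and \<open>Some (i, True)\<close>; the copies
  share exactly the vertex \<open>None\<close>.
\<close>

definition friendship_triangle :: "nat \<Rightarrow> (nat \<times> bool) option set" where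
  "friendship_triangle i = {None, Some (i, False), Some (i, True)}"

definition friendship_graph :: "nat \<Rightarrow> (nat \<times> bool) option pair_pre_digraph" where
  "friendship_graph n =
     \<lparr> pverts = (\<Union>i<n. friendship_triangle i),
       parcs = (\<Union>i<n. {(u, v). u \<in> friendship_triangle i \<and> v \<in> friendship_triangle i \<and> u \<noteq> v}) \<rparr>"

lemma pair_graph_friendship_graph: "pair_graph (friendship_graph n)"
proof -
  have "finite (parcs (friendship_graph n))"
    by (rule finite_subset[of _ "pverts (friendship_graph n) \<times> pverts (friendship_graph n)"])
       (auto simp: friendship_graph_def friendship_triangle_def)
  then show ?thesis
    by unfold_locales
       (auto simp: friendship_graph_def friendship_triangle_def symmetric_def intro!: symI)
qed

lemma graph_delete_verts:
  assumes "graph G"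
  shows "graph (delete_verts G S)"
proof -
  interpret graph G by fact
  have ind: "induced_subgraph (delete_verts G S) G"
    unfolding delete_verts_def by (rule induced_induce) auto
  show ?thesis
    using digraphI_induced[OF ind] induced_graph_imp_graph[OF ind]
    by (simp add: graph_def digraph_def pseudo_graph_def)
qed

end

theory Submission
  imports Defs
begin

text \<open>
  The centre has maximum degree and is adjacent to every other vertex, so it strongly dominates
  alone. Without the centre there are at least two disjoint edges, and no single vertex
  dominates both of them.
\<close>

text \<open>With at least one vertex present, the empty set dominates nothing, so 1 is a lower bound
  for the minimum. Whether it is attained becomes a question about single vertices, which serves
  both for the friendship graph and for the graph without its centre.\<close>

lemma strong_domination_number_eq_1_iff:
  assumes "finite (verts G)" and "verts G \<noteq> {}"
  shows "strong_domination_number G = 1 \<longleftrightarrow> (\<exists>c. strong_dominating_set G {c})"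
proof -
  let ?C = "{card D | D. strong_dominating_set G D}"
  have sub: "?C \<subseteq> card ` Pow (verts G)"
    by (auto simp: strong_dominating_set_def)
  have fin: "finite ?C"
    using finite_subset[OF sub] assms(1) by simp
  \<comment> \<open>The whole vertex set is a candidate, so the minimum is over a nonempty finite
    set and is attained by some \<open>D\<close>.\<close>
  have "strong_dominating_set G (verts G)"
    by (simp add: strong_dominating_set_def)
  then have "?C \<noteq> {}" by blast
  then have "Min ?C \<in> ?C"
    using fin Min_in by blast
  then obtain D where D: "strong_dominating_set G D" "Min ?C = card D" by blast
  have pos: "card E \<ge> 1" if "strong_dominating_set G E" for E
  proof -
    have "E \<noteq> {}" "finite E"
      using that assms by (auto simp: strong_dominating_set_def intro: finite_subset)
    then show ?thesis by (simp add: Suc_le_eq card_gt_0_iff)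
  qed
  show ?thesis
  proof
    assume "strong_domination_number G = 1"
    then have "card D = 1" using D(2) by (simp add: strong_domination_number_def)
    then show "\<exists>c. strong_dominating_set G {c}"
      using D(1) by (auto simp: card_1_singleton_iff)
  next
    assume "\<exists>c. strong_dominating_set G {c}"
    then obtain c where "strong_dominating_set G {c}" ..
    then have "card {c} \<in> ?C" by blast
    then have "Min ?C \<le> 1" using Min_le[OF fin] by fastforce
    then show "strong_domination_number G = 1"
      using pos[OF D(1)] D(2) by (simp add: strong_domination_number_def)
  qed
qed

lemma (in wf_digraph) delete_verts_empty: "delete_verts G {} = G"
  by (simp add: delete_verts_def induce_subgraph_def cong: conj_cong)

text \<open>Deleting nothing returns \<open>G\<close> itself and cannot change the number, so every
  admissible \<open>S\<close> is nonempty; \<open>{x}\<close> attains the resulting bound 1.\<close>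

lemma strong_domination_stability_eq_1:
  assumes "wf_digraph G" and "finite (verts G)" and "x \<in> verts G"
    and "strong_domination_number (delete_verts G {x}) \<noteq> strong_domination_number G"
  shows "strong_domination_stability G = 1"
proof -
  let ?C = "{card S | S. S \<subseteq> verts G \<and>
    strong_domination_number (delete_verts G S) \<noteq> strong_domination_number G}"
  have "?C \<subseteq> card ` Pow (verts G)" by auto
  then have fin: "finite ?C"
    using assms(2) finite_subset by blast
  have "card {x} \<in> ?C" using assms(3,4) by blast
  moreover have "1 \<le> k" if "k \<in> ?C" for k
  proof -
    from that obtain S where S: "k = card S" "S \<subseteq> verts G"
      "strong_domination_number (delete_verts G S) \<noteq> strong_domination_number G" by blast
    have "S \<noteq> {}" using S(3) wf_digraph.delete_verts_empty[OF assms(1)] by auto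
    moreover have "finite S" using S(2) assms(2) finite_subset by blast
    ultimately show ?thesis using S(1) by (simp add: Suc_le_eq card_gt_0_iff)
  qed
  ultimately have "Min ?C = 1"
    using fin by (intro Min_eqI) auto
  then show ?thesis by (simp add: strong_domination_stability_def)
qed

lemma verts_friendship_graph:
  "n > 0 \<Longrightarrow> verts (with_proj (friendship_graph n)) = insert None (Some ` ({..<n} \<times> UNIV))"
  by (auto simp: friendship_graph_def friendship_triangle_def UNIV_bool)

lemma verts_delete_centre:
  assumes "n > 0"
  shows "verts (delete_verts (with_proj (friendship_graph n)) {None}) = Some ` ({..<n} \<times> UNIV)"
  unfolding delete_verts_def induce_subgraph_verts verts_friendship_graph[OF assms] by auto

lemma arcs_friendship_graph:
  "(u, v) \<in> arcs (with_proj (friendship_graph n)) \<longleftrightarrow>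
     u \<noteq> v \<and> (\<exists>i<n. u \<in> friendship_triangle i \<and> v \<in> friendship_triangle i)"
  by (auto simp: friendship_graph_def)

lemma strong_dominating_set_friendship_graph:
  assumes "n > 0"
  shows "strong_dominating_set (with_proj (friendship_graph n)) {None}"
proof -
  let ?G = "with_proj (friendship_graph n)"
  interpret pair_graph "friendship_graph n" by (rule pair_graph_friendship_graph)
  have "v \<rightarrow>\<^bsub>?G\<^esub> None \<and> out_degree ?G v \<le> out_degree ?G None"
    if v: "v = Some (i, b)" "i < n" for v i b
  proof -
    \<comment> \<open>The degrees are compared inside triangle \<open>i\<close> alone:
      \<open>v\<close> has no neighbours outside it, while the centre has at least the two
      non-central vertices of it. Both bounds are 2, so the full degree of the centre is never
      computed.\<close>
    have "out_arcs ?G v \<subseteq> {(v, None), (v, Some (i, \<not> b))}"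
      using v by (auto simp: out_arcs_def friendship_graph_def friendship_triangle_def)
    then have "out_degree ?G v \<le> card {(v, None), (v, Some (i, \<not> b))}"
      unfolding out_degree_def by (intro card_mono) auto
    also have "\<dots> = card {(None, Some (i, False)), (None :: (nat \<times> bool) option, Some (i, True))}"
      by simp
    also have "\<dots> \<le> out_degree ?G None"
      unfolding out_degree_def
    proof (rule card_mono)
      show "finite (out_arcs ?G None)"
        using finite_arcs by (auto simp: out_arcs_def)
    qed (use v in \<open>auto simp: out_arcs_def friendship_graph_def friendship_triangle_def\<close>)
    finally have "out_degree ?G v \<le> out_degree ?G None" .
    moreover have "v \<rightarrow>\<^bsub>?G\<^esub> None"
      using v by (cases b) (auto simp: friendship_graph_def friendship_triangle_def)
    ultimately show ?thesis by simp
  qed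
  then show ?thesis
    unfolding strong_dominating_set_def verts_friendship_graph[OF assms] by auto
qed

lemma not_strong_dominating_set_delete_centre:
  assumes "n \<ge> 2"
  shows "\<not> strong_dominating_set (delete_verts (with_proj (friendship_graph n)) {None}) {c}"
proof
  let ?H = "delete_verts (with_proj (friendship_graph n)) {None}"
  assume sds: "strong_dominating_set ?H {c}"
  have verts: "verts ?H = Some ` ({..<n} \<times> UNIV)"
    using assms by (intro verts_delete_centre) simp
  obtain i b where c: "c = Some (i, b)"
    using sds verts by (auto simp: strong_dominating_set_def)
  \<comment> \<open>A triangle other than that of \<open>c\<close>; it exists because
    \<open>n \<ge> 2\<close>. Its vertex \<open>Some (j, b)\<close> differs from \<open>c\<close>,
    so \<open>c\<close> would have to be its neighbour.\<close>
  define j :: nat where "j = (if i = 0 then 1 else 0)"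
  have j: "j < n" "j \<noteq> i" using assms by (auto simp: j_def)
  then have "Some (j, b) \<rightarrow>\<^bsub>?H\<^esub> c"
    using sds verts c by (auto simp: strong_dominating_set_def)
  \<comment> \<open>Deletion creates no arcs, so this one would already join two vertices of a
    common triangle. A vertex other than the centre lies in only one triangle, which forces
    \<open>j = i\<close>.\<close>
  then have "(Some (j, b), c) \<in> arcs (with_proj (friendship_graph n))"
    by (auto simp: arcs_ends_def arc_to_ends_def delete_verts_def)
  then show False
    using j c by (auto simp: arcs_friendship_graph friendship_triangle_def simp del: with_proj_simps)
qed

theorem proposition2p6:
  fixes n :: nat
  assumes "n \<ge> 2"
  shows "strong_domination_stability (with_proj (friendship_graph n)) = 1"
proof -
  let ?G = "with_proj (friendship_graph n)"
  let ?H = "delete_verts ?G {None}"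
  interpret pair_graph "friendship_graph n" by (rule pair_graph_friendship_graph)
  have n: "n > 0" using assms by simp
  have "strong_domination_number ?G = 1"
    using strong_dominating_set_friendship_graph[OF n] verts_friendship_graph[OF n]
    by (subst strong_domination_number_eq_1_iff) auto
  \<comment> \<open>It suffices that the value differs from 1; the exact number for the remaining
    disjoint edges is not computed. The criterion applies because \<open>n > 0\<close> leaves
    vertices after the deletion.\<close>
  moreover have "strong_domination_number ?H \<noteq> 1"
    using not_strong_dominating_set_delete_centre[OF assms] verts_delete_centre[OF n] n
    by (subst strong_domination_number_eq_1_iff) auto
  ultimately show ?thesis
    using verts_friendship_graph[OF n]
    by (intro strong_domination_stability_eq_1[of _ None]) (auto simp: wf_digraph_wp_iff intro: wf_digraph_axioms)
qed

end
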